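(* Let $R$ be a finite commutative ring with unity, written as $R = R_1\times\cdots\times R_s$ with $R_i$ finite local rings, let $x = (x_1,\dots,x_s)$ be a nonzero element of $R$, and let $P = \{ i \in\{1,\dots,s\} : x_i \neq 0\}$. Then the eigenvalues of $\mathrm{Cay}(R, xR^* )$, counted with multiplicity, are: (i) for each subset $C \subseteq P$ (including $C=\emptyset$), the value $$(-1)^{|C|}\frac{|xR^*|}{\prod_{i\in C}\frac{|x_iR_i^*|}{|M_{x_i}|}}$$ with multiplicity $\frac{|R|}{|I_x|}\prod_{i\in C}\frac{|x_iR_i^*|}{|M_{x_i}|}$; (ii) $0$ with multiplicity $|R| - \frac{|R|}{|I_x|}\prod_{i\in P}\left(1 + \frac{|x_iR_i^*|}{|M_{x_i}|}\right)$.
   Context: For a finite commutative ring $S$ with unity, $S^*$ is its unit group and $yS^* = \{yr : r\in S^*\}$ for $y \in S$. $\mathrm{Cay}(R, xR^* )$ is the graph with vertex set $R$ in which $u,v$ are adjacent iff $u - v\in xR^*$; eigenvalues are those of its $(0,1)$-adjacency matrix. $I_x$ is the ideal of $R$ generated by $x$. For each $i$, $I_{x_i}$ is the ideal of $R_i$ generated by $x_i$ and $M_{x_i} = I_{x_i}\setminus x_iR_i^*$. *)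

theory Defs
  imports
    "HOL-Algebra.Chinese_Remainder"
    "Graph_Theory.Pair_Digraph"
    "Jordan_Normal_Form.Char_Poly"
begin

definition local_ring :: "('a, 'm) ring_scheme \<Rightarrow> bool" where
  "local_ring R \<longleftrightarrow> cring R \<and> (\<exists>!M. maximalideal M R)"

definition unit_multiples :: "('a, 'm) ring_scheme \<Rightarrow> 'a \<Rightarrow> 'a set" where
  "unit_multiples R y = {y \<otimes>\<^bsub>R\<^esub> r | r. r \<in> Units R}"

text \<open>The set \<open>M\<^sub>y = I\<^sub>y - yR\<^sup>*\<close>, where \<open>I\<^sub>y\<close> is the ideal generated by \<open>y\<close>.\<close>

definition nonunit_multiples :: "('a, 'm) ring_scheme \<Rightarrow> 'a \<Rightarrow> 'a set" where
  "nonunit_multiples R y = Idl\<^bsub>R\<^esub> {y} - unit_multiples R y"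

text \<open>For \<open>S = xR\<^sup>*\<close> the adjacency relation is symmetric, as \<open>-1\<close> is a unit, so the
  digraph below represents an undirected graph.\<close>

definition Cay :: "('a, 'm) ring_scheme \<Rightarrow> 'a set \<Rightarrow> 'a pair_pre_digraph" where
  "Cay R S = \<lparr> pverts = carrier R,
     parcs = {(u, v). u \<in> carrier R \<and> v \<in> carrier R \<and> u \<ominus>\<^bsub>R\<^esub> v \<in> S} \<rparr>"

text \<open>The list \<open>vs\<close> enumerates the vertices and thereby fixes the order of rows and columns.\<close>

definition adjacency_matrix :: "'a pair_pre_digraph \<Rightarrow> 'a list \<Rightarrow> 'b :: zero_neq_one mat" where
  "adjacency_matrix G vs =
     mat (length vs) (length vs) (\<lambda>(i, j). if (vs ! i, vs ! j) \<in> parcs G then 1 else 0)"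

text \<open>The eigenvalues of a complex matrix with algebraic multiplicities, which for the symmetric
  matrices considered here agree with the geometric ones.\<close>

definition eigenvalue_mset :: "complex mat \<Rightarrow> complex multiset" where
  "eigenvalue_mset A = proots (char_poly A)"

end

theory Submission
  imports
    Defs
    "Jordan_Normal_Form.Schur_Decomposition"
begin

text \<open>By Schur triangularisation the \<open>k\<close>-th power sum of the eigenvalues is the trace of the
  \<open>k\<close>-th power of the adjacency matrix, that is, \<open>|R|\<close> times the number of closed walks of
  length \<open>k\<close> at \<open>0\<close>; a multiset of complex numbers is determined by its power sums. Closed walk
  counts are multiplicative over direct products, so it suffices to count walks in a local factor.
  There \<open>M\<^sub>y\<close> is the set of multiples of \<open>y\<close> by nonunits, hence an additive subgroup of \<open>I\<^sub>y\<close>, and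
  the connection set is the difference of these two subgroups. With \<open>q = |yR\<^sup>*| / |M\<^sub>y|\<close>, this makes
  the \<open>k\<close>-th trace of the factor equal to \<open>|R| / |I\<^sub>y| * |yR\<^sup>*|\<^sup>k * (1 + q (-1/q)\<^sup>k)\<close> for \<open>k > 0\<close>,
  and expanding the product of these sums over the factors gives a sum over subsets.\<close>

section \<open>Power sums, traces and eigenvalues\<close>

text \<open>Equal power sums give equal sums of every polynomial over the two multisets. A
  polynomial that vanishes at all their elements except \<open>a\<close> then isolates the
  multiplicity of \<open>a\<close>. The exponent 0 is included, so the sizes are compared as
  well.\<close>

lemma multiset_eq_if_power_sums_eq:
  fixes S T :: "'a :: field_char_0 multiset"
  assumes power_sums: "\<And>k. (\<Sum>z\<in>#S. z ^ k) = (\<Sum>z\<in>#T. z ^ k)"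
  shows "S = T"
proof (rule multiset_eqI)
  fix a
  \<comment> \<open>The roots of \<open>p\<close> are exactly the elements of \<open>S\<close> and
    \<open>T\<close> other than \<open>a\<close>, so only copies of \<open>a\<close> contribute to a
    sum of values of \<open>p\<close>.\<close>
  define p where "p = (\<Prod>w\<in>(set_mset S \<union> set_mset T) - {a}. [:-w, 1:])"
  have poly_sum: "(\<Sum>z\<in>#U. poly p z) = (\<Sum>i\<le>degree p. coeff p i * (\<Sum>z\<in>#U. z ^ i))"
    for U :: "'a multiset"
    by (induction U) (auto simp: poly_altdef sum.distrib algebra_simps)
  have poly_count: "(\<Sum>z\<in>#U. poly p z) = of_nat (count U a) * poly p a"
    if "set_mset U \<subseteq> set_mset S \<union> set_mset T" for U
    using that
  proof (induction U)
    case (add z U)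
    have "poly p z = 0" if "z \<noteq> a"
      using that add.prems unfolding p_def poly_prod
      by (intro prod_zero) auto
    with add show ?case by (auto simp: algebra_simps)
  qed simp
  have "poly p a \<noteq> 0"
    unfolding p_def poly_prod by (subst prod_zero_iff) auto
  moreover have "(\<Sum>z\<in>#S. poly p z) = (\<Sum>z\<in>#T. poly p z)"
    unfolding poly_sum power_sums ..
  ultimately show "count S a = count T a"
    by (simp add: poly_count)
qed

lemma sum_diag_mult_commute:
  fixes A B :: "'a :: comm_semiring_0 mat"
  assumes "A \<in> carrier_mat n m" and "B \<in> carrier_mat m n"
  shows "(\<Sum>i<n. (A * B) $$ (i, i)) = (\<Sum>i<m. (B * A) $$ (i, i))"
proof -
  have "(\<Sum>i<n. (A * B) $$ (i, i)) = (\<Sum>i<n. \<Sum>j<m. A $$ (i, j) * B $$ (j, i))"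
    using assms by (intro sum.cong) (auto simp: scalar_prod_def atLeast0LessThan)
  also have "\<dots> = (\<Sum>j<m. \<Sum>i<n. B $$ (j, i) * A $$ (i, j))"
    by (subst sum.swap) (simp add: mult.commute)
  also have "\<dots> = (\<Sum>j<m. (B * A) $$ (j, j))"
    using assms by (intro sum.cong) (auto simp: scalar_prod_def atLeast0LessThan)
  finally show ?thesis .
qed

lemma upper_triangular_pow:
  fixes B :: "'a :: semiring_1 mat"
  assumes B: "B \<in> carrier_mat n n" and "upper_triangular B"
  shows "upper_triangular (B ^\<^sub>m k)"
    and "i < n \<Longrightarrow> (B ^\<^sub>m k) $$ (i, i) = B $$ (i, i) ^ k"
proof -
  have "(\<forall>i<n. \<forall>j<i. (B ^\<^sub>m k) $$ (i, j) = 0) \<and> (\<forall>i<n. (B ^\<^sub>m k) $$ (i, i) = B $$ (i, i) ^ k)"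
  proof (induction k)
    case (Suc k)
    have entry: "(B ^\<^sub>m Suc k) $$ (i, j) = (\<Sum>l<n. (B ^\<^sub>m k) $$ (i, l) * B $$ (l, j))"
      if "i < n" "j < n" for i j
      using B that by (auto simp: scalar_prod_def atLeast0LessThan intro!: sum.cong)
    \<comment> \<open>For \<open>l < i\<close> the first factor lies below the diagonal; otherwise
      \<open>j < l\<close>, and the second one does. Only \<open>l = i = j\<close> escapes.\<close>
    have vanish: "(B ^\<^sub>m k) $$ (i, l) * B $$ (l, j) = 0"
      if "i < n" "l < n" "j \<le> i" "\<not> (l = i \<and> j = i)" for i j l
    proof (cases "l < i")
      case True
      with Suc that show ?thesis by auto
    next
      case False
      with that have "j < l" by auto
      with assms that show ?thesis by (auto simp: upper_triangular_def)
    qed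
    have "(B ^\<^sub>m Suc k) $$ (i, i) = B $$ (i, i) ^ Suc k" if "i < n" for i
    proof -
      have "(B ^\<^sub>m Suc k) $$ (i, i) = (\<Sum>l<n. if l = i then (B ^\<^sub>m k) $$ (i, i) * B $$ (i, i) else 0)"
        unfolding entry[OF that that] using vanish that by (intro sum.cong) auto
      then show ?thesis using Suc that by (simp add: power_commutes)
    qed
    moreover have "(B ^\<^sub>m Suc k) $$ (i, j) = 0" if "i < n" "j < i" for i j
      using that entry vanish by (auto intro!: sum.neutral)
    ultimately show ?case by blast
  qed (use B in auto)
  with B show "upper_triangular (B ^\<^sub>m k)"
    and "i < n \<Longrightarrow> (B ^\<^sub>m k) $$ (i, i) = B $$ (i, i) ^ k"
    by (auto simp: upper_triangular_def)
qed

lemma size_eigenvalue_mset: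
  assumes "A \<in> carrier_mat n n"
  shows "size (eigenvalue_mset A) = n"
  using degree_monic_char_poly[OF assms] by (simp add: eigenvalue_mset_def size_proots_complex)

text \<open>The characteristic polynomial splits over the complex numbers, so \<open>A\<close> is
  similar to a triangular matrix with the eigenvalues on its diagonal. Powers act entrywise on that
  diagonal, and the trace is invariant under similarity.\<close>

lemma eigenvalue_mset_power_sum:
  assumes A: "A \<in> carrier_mat n n"
  shows "(\<Sum>z\<in>#eigenvalue_mset A. z ^ k) = (\<Sum>i<n. (A ^\<^sub>m k) $$ (i, i))"
proof -
  obtain es where es: "char_poly A = (\<Prod>e\<leftarrow>es. [:- e, 1:])"
    using char_poly_factorized[OF A] by blast
  obtain B P Q where "schur_decomposition A es = (B, P, Q)"
    by (cases "schur_decomposition A es")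
  from schur_decomposition[OF A es this]
  have wit: "similar_mat_wit A B P Q" and B: "upper_triangular B" and diag: "diag_mat B = es"
    by auto
  from wit A have carr: "B \<in> carrier_mat n n" "P \<in> carrier_mat n n" "Q \<in> carrier_mat n n"
    and QP: "Q * P = 1\<^sub>m n"
    by (auto simp: similar_mat_wit_def Let_def)
  have Bk: "B ^\<^sub>m k \<in> carrier_mat n n" using carr by simp
  have "proots (\<Prod>e\<leftarrow>fs. [:- e, 1:]) = mset fs" for fs :: "complex list"
  proof (induction fs)
    case (Cons f fs)
    have "(\<Prod>e\<leftarrow>fs. [:- e, 1:]) \<noteq> 0" by (auto simp: prod_list_zero_iff)
    then show ?case using Cons by (simp add: proots_mult del: mult_pCons_left)
  qed simp
  then have "proots (char_poly A) = mset es" unfolding es .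
  then have "(\<Sum>z\<in>#eigenvalue_mset A. z ^ k) = (\<Sum>e\<leftarrow>es. e ^ k)"
    by (simp add: eigenvalue_mset_def flip: sum_mset_sum_list)
  also have "\<dots> = (\<Sum>i<n. B $$ (i, i) ^ k)"
    using carr by (simp flip: diag add: diag_mat_def o_def interv_sum_list_conv_sum_set_nat atLeast0LessThan)
  also have "\<dots> = (\<Sum>i<n. (B ^\<^sub>m k) $$ (i, i))"
    using upper_triangular_pow(2)[OF carr(1) B] by simp
  \<comment> \<open>Inserting \<open>Q * P = 1\<close> lets the cyclic property of the trace turn
    the power of \<open>B\<close> into the power of \<open>A\<close>.\<close>
  also have "B ^\<^sub>m k = (B ^\<^sub>m k * Q) * P"
    using carr Bk QP by (simp add: assoc_mult_mat[of _ n n _ n _ n])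
  also have "(\<Sum>i<n. (B ^\<^sub>m k * Q * P) $$ (i, i)) = (\<Sum>i<n. (P * (B ^\<^sub>m k * Q)) $$ (i, i))"
    using carr Bk by (intro sum_diag_mult_commute[of _ n n]) auto
  also have "P * (B ^\<^sub>m k * Q) = A ^\<^sub>m k"
    using carr Bk similar_mat_wit_pow_id[OF wit, of k] by (simp add: assoc_mult_mat[of _ n n _ n _ n])
  finally show ?thesis .
qed

section \<open>Counting walks in Cayley graphs\<close>

text \<open>In a finite ring, for \<open>S\<close> in the carrier and \<open>g\<close> in the
  carrier, this is the \<open>k\<close>-fold convolution power of the indicator of \<open>S\<close>:
  the number of sequences of \<open>k\<close> elements of \<open>S\<close> with sum
  \<open>g\<close>.\<close>

fun walks :: "('a, 'm) ring_scheme \<Rightarrow> 'a set \<Rightarrow> nat \<Rightarrow> 'a \<Rightarrow> nat" where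
  "walks R S 0 g = (if g = \<zero>\<^bsub>R\<^esub> then 1 else 0)"
| "walks R S (Suc k) g = (\<Sum>h | h \<in> carrier R \<and> g \<ominus>\<^bsub>R\<^esub> h \<in> S. walks R S k h)"

lemma (in ring) minus_minus_cancel:
  assumes "a \<in> carrier R" "b \<in> carrier R" "c \<in> carrier R"
  shows "(a \<ominus> b) \<ominus> (a \<ominus> c) = c \<ominus> b"
  using assms by (simp add: minus_eq minus_add a_ac r_neg1 r_neg2)

lemma (in ring) minus_minus_cancel':
  assumes "a \<in> carrier R" "b \<in> carrier R"
  shows "a \<ominus> (a \<ominus> b) = b"
  using assms by (simp add: minus_eq minus_add r_neg1 r_neg2)

text \<open>Translations are automorphisms of a Cayley graph, so the number of walks between two
  vertices depends only on their difference.\<close>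

lemma (in ring) adjacency_matrix_Cay_pow:
  fixes vs :: "'a list"
  assumes "distinct vs" and vs: "set vs = carrier R" and "i < length vs" and "j < length vs"
  shows "(adjacency_matrix (Cay R S) vs ^\<^sub>m k) $$ (i, j) =
    (of_nat (walks R S k (vs ! i \<ominus> vs ! j)) :: 'c :: semiring_1)"
  using \<open>j < length vs\<close>
proof (induction k arbitrary: j)
  case 0
  have "vs ! i = vs ! j \<longleftrightarrow> i = j"
    using assms(1,3) 0 nth_eq_iff_index_eq by blast
  moreover have "vs ! i \<ominus> vs ! j = \<zero> \<longleftrightarrow> vs ! i = vs ! j"
    using assms 0 nth_mem by (metis a_minus_def add.inv_closed minus_equality r_neg)
  ultimately show ?case using assms 0 by (auto simp: adjacency_matrix_def)
next
  case (Suc k)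
  let ?A = "adjacency_matrix (Cay R S) vs :: 'c mat" and ?n = "length vs"
  let ?f = "\<lambda>v. vs ! i \<ominus> v"
  have in_R: "vs ! l \<in> carrier R" if "l < ?n" for l using that vs by force
  have A: "?A \<in> carrier_mat ?n ?n" by (simp add: adjacency_matrix_def)
  have fin: "finite (carrier R)" unfolding vs[symmetric] by simp
  have "(?A ^\<^sub>m Suc k) $$ (i, j) = (\<Sum>l<?n. (?A ^\<^sub>m k) $$ (i, l) * ?A $$ (l, j))"
    using A Suc.prems assms(3) by (auto simp: scalar_prod_def atLeast0LessThan intro!: sum.cong)
  also have "\<dots> = (\<Sum>l<?n. if vs ! l \<ominus> vs ! j \<in> S then of_nat (walks R S k (?f (vs ! l))) else 0)"
    using Suc in_R by (intro sum.cong) (auto simp: adjacency_matrix_def Cay_def)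
  also have "\<dots> = (\<Sum>v\<in>carrier R. if v \<ominus> vs ! j \<in> S then of_nat (walks R S k (?f v)) else 0)"
    using assms(1) unfolding vs[symmetric] by (intro sum.reindex_bij_betw bij_betw_nth) auto
  \<comment> \<open>Substitute \<open>h = vs ! i - v\<close>. This map is an involution, and the
    condition becomes the one in the recursion for \<open>walks\<close> because
    \<open>v - vs ! j\<close> equals \<open>(vs ! i - vs ! j) - h\<close>.\<close>
  also have "\<dots> = (\<Sum>h\<in>carrier R. if ?f (vs ! j) \<ominus> h \<in> S then of_nat (walks R S k h) else 0)"
    by (rule sum.reindex_bij_witness[of _ ?f ?f])
      (use in_R Suc.prems assms(3) in \<open>auto simp: minus_minus_cancel minus_minus_cancel'\<close>)
  also have "\<dots> = of_nat (walks R S (Suc k) (?f (vs ! j)))"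
    using fin by (auto simp: of_nat_sum sum.inter_filter intro!: sum.cong)
  finally show ?case .
qed

text \<open>The indicator of \<open>I - M\<close> is a difference of indicators of subgroups, and convolving
  indicators of nested subgroups only rescales the one of the larger subgroup.\<close>

lemma (in ring) walks_subgroup_diff:
  assumes fin: "finite (carrier R)"
    and I: "additive_subgroup I R" and M: "additive_subgroup M R" and MI: "M \<subseteq> I"
    and g: "g \<in> carrier R" and k: "k > 0"
  shows "real (walks R (I - M) k g) =
    (real (card I - card M) ^ k - (- real (card M)) ^ k) / card I * of_bool (g \<in> I)
    + (- real (card M)) ^ k / card M * of_bool (g \<in> M)"
proof -
  interpret I: additive_subgroup I R by (fact I)
  interpret M: additive_subgroup M R by (fact M)
  have fin_I: "finite I" and fin_M: "finite M"
    using finite_subset[OF _ fin] I.a_subset M.a_subset by auto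
  have pos: "card I > 0" "card M > 0"
    using fin_I fin_M I.zero_closed M.zero_closed unfolding card_gt_0_iff by blast+
  have le: "card M \<le> card I" using fin_I MI by (rule card_mono)
  show ?thesis
    using k g
  proof (induction k arbitrary: g rule: nat_induct_non_zero)
    case 1
    \<comment> \<open>Only \<open>h = 0\<close> carries a walk of length 0, so the count is the
      indicator of \<open>I - M\<close>; at \<open>k = 1\<close> the two coefficients of the formula
      are 1 and -1.\<close>
    have "{h. h \<in> carrier R \<and> g \<ominus> h \<in> I - M} \<inter> {\<zero>} = (if g \<in> I - M then {\<zero>} else {})"
      using 1 by (auto simp: minus_eq)
    then have "walks R (I - M) 1 g = of_bool (g \<in> I - M)"
      using fin 1 by (simp add: sum.If_cases Collect_conj_eq Int_assoc minus_eq)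
    then show ?case
      using pos le MI by (auto simp: of_nat_diff field_simps)
  next
    case (Suc k)
    note g = \<open>g \<in> carrier R\<close>
    have I_minus: "g \<ominus> h \<in> I \<longleftrightarrow> g \<in> I" if "h \<in> I" for h
    proof
      assume "g \<ominus> h \<in> I"
      then have "g \<ominus> h \<oplus> h \<in> I" using that by (rule I.a_closed)
      then show "g \<in> I" using g I.a_Hcarr[OF that] by (simp add: minus_eq a_assoc l_neg)
    qed (use that in \<open>auto simp: minus_eq\<close>)
    have M_minus: "g \<ominus> h \<in> M \<longleftrightarrow> g \<in> M" if "h \<in> M" for h
    proof
      assume "g \<ominus> h \<in> M"
      then have "g \<ominus> h \<oplus> h \<in> M" using that by (rule M.a_closed)
      then show "g \<in> M" using g M.a_Hcarr[OF that] by (simp add: minus_eq a_assoc l_neg)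
    qed (use that in \<open>auto simp: minus_eq\<close>)
    \<comment> \<open>By the induction hypothesis the summand over \<open>H\<close> is a combination
      of the indicators of \<open>I\<close> and \<open>M\<close>, so the sum needs only the sizes of
      \<open>H \<inter> I\<close> and \<open>H \<inter> M\<close>.\<close>
    define H where "H = {h. h \<in> carrier R \<and> g \<ominus> h \<in> I - M}"
    have fin_H: "finite H" using fin by (simp add: H_def)
    have card_HI: "card (H \<inter> I) = (if g \<in> I then card I - card M else 0)"
    proof (cases "g \<in> I")
      case True
      have "bij_betw (\<lambda>h. g \<ominus> h) (H \<inter> I) (I - M)"
      proof (rule bij_betw_byWitness[where f' = "\<lambda>h. g \<ominus> h"])
        show "(\<lambda>h. g \<ominus> h) ` (I - M) \<subseteq> H \<inter> I"
        proof (rule image_subsetI)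
          fix h assume h: "h \<in> I - M"
          then have "h \<in> carrier R" using I.a_Hcarr by simp
          with True g h I_minus[of h] show "g \<ominus> h \<in> H \<inter> I" by (simp add: H_def minus_minus_cancel')
        qed
        show "\<forall>h\<in>I - M. g \<ominus> (g \<ominus> h) = h"
          using g minus_minus_cancel' I.a_Hcarr by blast
      qed (use g in \<open>auto simp: H_def minus_minus_cancel'\<close>)
      then have "card (H \<inter> I) = card (I - M)" by (rule bij_betw_same_card)
      with True fin_M MI show ?thesis by (simp add: card_Diff_subset)
    next
      case False
      then have "H \<inter> I = {}" using I_minus by (auto simp: H_def)
      with False show ?thesis by simp
    qed
    \<comment> \<open>For \<open>h\<close> in \<open>M\<close>, subtracting \<open>h\<close> changes
      membership of \<open>g\<close> neither in \<open>I\<close> nor in \<open>M\<close>, so either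
      all of \<open>M\<close> qualifies or none of it.\<close>
    have "H \<inter> M = (if g \<in> I - M then M else {})"
      using I_minus M_minus MI M.a_Hcarr by (auto simp: H_def)
    then have card_HM: "card (H \<inter> M) = (if g \<in> I - M then card M else 0)" by simp
    define a where "a = (real (card I - card M) ^ k - (- real (card M)) ^ k) / card I"
    define b where "b = (- real (card M)) ^ k / card M"
    have "real (walks R (I - M) (Suc k) g) = (\<Sum>h\<in>H. real (walks R (I - M) k h))"
      by (simp add: H_def)
    also have "\<dots> = (\<Sum>h\<in>H. a * of_bool (h \<in> I) + b * of_bool (h \<in> M))"
      using Suc.IH by (intro sum.cong) (auto simp: H_def a_def b_def)
    also have "\<dots> = a * card (H \<inter> I) + b * card (H \<inter> M)"
      using fin_H by (simp add: sum.distrib flip: sum_distrib_left)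
    finally have walks_eq: "real (walks R (I - M) (Suc k) g) = \<dots>" .
    show ?case
      using pos le MI unfolding walks_eq card_HI card_HM a_def b_def
      by (auto simp: of_nat_diff field_simps)
  qed
qed

section \<open>Multiples of an element in a finite local ring\<close>

text \<open>There are finitely many ideals, so a proper ideal that is maximal under inclusion above
  \<open>J\<close> exists without Zorn's lemma.\<close>

lemma (in cring) exists_maximalideal_supset:
  assumes fin: "finite (carrier R)" and J: "ideal J R" and "J \<noteq> carrier R"
  obtains N where "maximalideal N R" and "J \<subseteq> N"
proof -
  let ?\<A> = "{N. ideal N R \<and> N \<noteq> carrier R}"
  have "?\<A> \<subseteq> Pow (carrier R)"
    by (auto dest: ideal.Icarr)
  then have "finite ?\<A>" using fin by (simp add: finite_subset)
  from finite_has_maximal2[OF this, of J] assms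
  obtain N where N: "ideal N R" "N \<noteq> carrier R" "J \<subseteq> N"
    and max: "\<And>K. ideal K R \<Longrightarrow> K \<noteq> carrier R \<Longrightarrow> N \<subseteq> K \<Longrightarrow> N = K"
    by auto
  have "maximalideal N R"
    by (rule maximalidealI) (use N max in auto)
  with N that show thesis by blast
qed

text \<open>The nonunits are the unique maximal ideal: it contains no unit, and each nonunit
  generates a proper ideal, which lies in some maximal ideal and hence in this one.\<close>

lemma local_ring_nonunits_ideal:
  fixes R (structure)
  assumes "local_ring R" and fin: "finite (carrier R)"
  shows "ideal (carrier R - Units R) R"
proof -
  interpret cring R using assms by (simp add: local_ring_def)
  obtain N where N: "maximalideal N R" and unique: "\<And>K. maximalideal K R \<Longrightarrow> K = N"
    using assms by (auto simp: local_ring_def)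
  interpret N: maximalideal N R by (fact N)
  have "u \<notin> N" if u: "u \<in> Units R" for u
  proof
    assume "u \<in> N"
    then have "inv u \<otimes> u \<in> N" using u by (intro N.I_l_closed) auto
    then have "\<one> \<in> N" using u by simp
    then show False using N.one_imp_carrier N.I_notcarr by simp
  qed
  moreover have "a \<in> N" if a: "a \<in> carrier R" "a \<notin> Units R" for a
  proof -
    have "\<one> \<notin> PIdl a"
      using a m_comm unfolding cgenideal_def Units_def by force
    then have "PIdl a \<noteq> carrier R" by auto
    from exists_maximalideal_supset[OF fin cgenideal_ideal[OF a(1)] this]
    show ?thesis using unique cgenideal_self[OF a(1)] by blast
  qed
  ultimately have "carrier R - Units R = N" using N.Icarr by blast
  then show ?thesis using N.is_ideal by simp
qed

lemma unit_multiples_subset_genideal: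
  fixes R (structure)
  assumes "cring R" and y: "y \<in> carrier R"
  shows "unit_multiples R y \<subseteq> Idl\<^bsub>R\<^esub> {y}"
proof -
  interpret cring R by fact
  show ?thesis
    using y m_comm unfolding unit_multiples_def cgenideal_eq_genideal[OF y, symmetric] cgenideal_def
    by blast
qed

text \<open>The point is that no element is both a unit multiple and a nonunit multiple of
  \<open>y\<close>. If \<open>y * n = y * u\<close> with \<open>n\<close> a nonunit and
  \<open>u\<close> a unit, then \<open>u - n\<close> is a unit, since otherwise \<open>u\<close>
  would be a sum of two nonunits. It annihilates \<open>y\<close>, which forces
  \<open>y = 0\<close>.\<close>

lemma local_ring_nonunit_multiples:
  fixes R (structure)
  assumes loc: "local_ring R" and fin: "finite (carrier R)"
    and y: "y \<in> carrier R" and y_nonzero: "y \<noteq> \<zero>\<^bsub>R\<^esub>"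
  shows "nonunit_multiples R y = (\<lambda>r. y \<otimes>\<^bsub>R\<^esub> r) ` (carrier R - Units R)"
proof -
  interpret cring R using loc by (simp add: local_ring_def)
  interpret N: ideal "carrier R - Units R" R by (rule local_ring_nonunits_ideal[OF loc fin])
  have "y \<otimes> n \<notin> unit_multiples R y" if n: "n \<in> carrier R - Units R" for n
  proof
    assume "y \<otimes> n \<in> unit_multiples R y"
    then obtain u where u: "u \<in> Units R" and eq: "y \<otimes> n = y \<otimes> u"
      by (auto simp: unit_multiples_def)
    let ?v = "u \<ominus> n"
    have v_carr: "?v \<in> carrier R" using u n by auto
    have "?v \<in> Units R"
    proof (rule ccontr)
      assume "?v \<notin> Units R"
      then have "?v \<oplus> n \<in> carrier R - Units R" using v_carr n by (intro N.a_closed) auto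
      moreover have "?v \<oplus> n = u" using u n by (simp add: minus_eq a_assoc l_neg Units_closed)
      ultimately show False using u by simp
    qed
    moreover have "y \<otimes> ?v = \<zero>"
      using u n y eq by (simp add: minus_eq r_distr r_minus r_neg Units_closed)
    ultimately have "y \<otimes> (?v \<otimes> inv ?v) = \<zero>"
      using y v_carr by (simp add: m_assoc[symmetric] del: Units_r_inv)
    then show False using \<open>?v \<in> Units R\<close> y y_nonzero by simp
  qed
  moreover have "Idl {y} = (\<lambda>r. y \<otimes> r) ` carrier R"
    using y m_comm unfolding cgenideal_eq_genideal[OF y, symmetric] cgenideal_def by blast
  moreover have "unit_multiples R y = (\<lambda>r. y \<otimes> r) ` Units R"
    unfolding unit_multiples_def by blast
  ultimately show ?thesis unfolding nonunit_multiples_def by blast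
qed

text \<open>Multiplication by \<open>y\<close> is additive, and the nonunits form an additive
  group.\<close>

lemma local_ring_nonunit_multiples_subgroup:
  fixes R (structure)
  assumes loc: "local_ring R" and fin: "finite (carrier R)"
    and y: "y \<in> carrier R" and y_nonzero: "y \<noteq> \<zero>\<^bsub>R\<^esub>"
  shows "additive_subgroup (nonunit_multiples R y) R"
proof -
  interpret cring R using loc by (simp add: local_ring_def)
  interpret N: ideal "carrier R - Units R" R by (rule local_ring_nonunits_ideal[OF loc fin])
  let ?N = "carrier R - Units R"
  have "subgroup ((\<lambda>r. y \<otimes> r) ` ?N) (add_monoid R)"
  proof (rule add.subgroupI)
    show "(\<lambda>r. y \<otimes> r) ` ?N \<subseteq> carrier R" using y by auto
    show "(\<lambda>r. y \<otimes> r) ` ?N \<noteq> {}" using N.zero_closed by blast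
  next
    fix a assume "a \<in> (\<lambda>r. y \<otimes> r) ` ?N"
    then obtain r where r: "r \<in> ?N" "a = y \<otimes> r" by blast
    then have "\<ominus> a = y \<otimes> (\<ominus> r)" "\<ominus> r \<in> ?N"
      using y N.a_inv_closed[of r] by (simp_all add: r_minus)
    then show "\<ominus> a \<in> (\<lambda>r. y \<otimes> r) ` ?N" by blast
  next
    fix a b assume "a \<in> (\<lambda>r. y \<otimes> r) ` ?N" "b \<in> (\<lambda>r. y \<otimes> r) ` ?N"
    then obtain r s where r: "r \<in> ?N" "a = y \<otimes> r" and s: "s \<in> ?N" "b = y \<otimes> s" by blast
    then have "a \<oplus> b = y \<otimes> (r \<oplus> s)" "r \<oplus> s \<in> ?N"
      using y N.a_closed[of r s] by (simp_all add: r_distr)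
    then show "a \<oplus> b \<in> (\<lambda>r. y \<otimes> r) ` ?N" by blast
  qed
  then show ?thesis
    unfolding local_ring_nonunit_multiples[OF assms] by (rule additive_subgroupI)
qed

section \<open>Direct products, one factor at a time\<close>

text \<open>The operations are transported from the binary product along the ring homomorphism that
  sends a pair to a list.\<close>

lemma RDirProd_list_Cons_simps:
  assumes "e \<in> carrier R" "b \<in> carrier R"
    and "es \<in> carrier (RDirProd_list Rs)" "bs \<in> carrier (RDirProd_list Rs)"
  shows "(e # es) \<otimes>\<^bsub>RDirProd_list (R # Rs)\<^esub> (b # bs) = (e \<otimes>\<^bsub>R\<^esub> b) # (es \<otimes>\<^bsub>RDirProd_list Rs\<^esub> bs)"
    and "(e # es) \<oplus>\<^bsub>RDirProd_list (R # Rs)\<^esub> (b # bs) = (e \<oplus>\<^bsub>R\<^esub> b) # (es \<oplus>\<^bsub>RDirProd_list Rs\<^esub> bs)"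
proof -
  have "(e, es) \<in> carrier (RDirProd R (RDirProd_list Rs))"
    "(b, bs) \<in> carrier (RDirProd R (RDirProd_list Rs))"
    using assms by (auto simp: RDirProd_carrier)
  from ring_hom_mult[OF RDirProd_list_hom1 this] ring_hom_add[OF RDirProd_list_hom1 this]
  show "(e # es) \<otimes>\<^bsub>RDirProd_list (R # Rs)\<^esub> (b # bs) = (e \<otimes>\<^bsub>R\<^esub> b) # (es \<otimes>\<^bsub>RDirProd_list Rs\<^esub> bs)"
    and "(e # es) \<oplus>\<^bsub>RDirProd_list (R # Rs)\<^esub> (b # bs) = (e \<oplus>\<^bsub>R\<^esub> b) # (es \<oplus>\<^bsub>RDirProd_list Rs\<^esub> bs)"
    by (simp_all add: RDirProd_def DirProd_def monoid.defs)
qed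

lemma RDirProd_list_one':
  "\<one>\<^bsub>RDirProd_list (R # Rs)\<^esub> = \<one>\<^bsub>R\<^esub> # \<one>\<^bsub>RDirProd_list Rs\<^esub>"
  unfolding RDirProd_list_one by simp

lemma RDirProd_list_Cons_mem [simp]:
  "e # es \<in> carrier (RDirProd_list (R # Rs)) \<longleftrightarrow> e \<in> carrier R \<and> es \<in> carrier (RDirProd_list Rs)"
  unfolding RDirProd_list_carrier by auto

lemma RDirProd_list_is_cring:
  assumes "\<And>i. i < length Rs \<Longrightarrow> cring (Rs ! i)"
  shows "cring (RDirProd_list Rs)"
proof -
  interpret ring "RDirProd_list Rs"
    using assms by (intro RDirProd_list_is_ring cring.axioms(1))
  have "x \<otimes>\<^bsub>RDirProd_list Rs\<^esub> y = y \<otimes>\<^bsub>RDirProd_list Rs\<^esub> x"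
    if "x \<in> carrier (RDirProd_list Rs)" "y \<in> carrier (RDirProd_list Rs)" for x y
    using assms that
  proof (induction Rs arbitrary: x y)
    case Nil
    then show ?case by simp
  next
    case (Cons R Rs)
    interpret R: cring R using Cons.prems(1)[of 0] by simp
    have "\<And>i. i < length Rs \<Longrightarrow> cring (Rs ! i)" using Cons.prems(1)[of "Suc _"] by simp
    note IH = Cons.IH[OF this]
    from Cons.prems(2,3) show ?case
      using IH R.m_comm unfolding RDirProd_list_carrier
      by (auto simp: RDirProd_list_Cons_simps)
  qed
  then show ?thesis by unfold_locales
qed

context
  fixes R :: "('a, 'm) ring_scheme" and Rs :: "('a, 'm) ring_scheme list"
  assumes cring_R: "cring R" and cring_Rs: "cring (RDirProd_list Rs)"
    and cring_Cons: "cring (RDirProd_list (R # Rs))"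
begin

interpretation R: cring R by (fact cring_R)
interpretation Rs: cring "RDirProd_list Rs" by (fact cring_Rs)
interpretation RRs: cring "RDirProd_list (R # Rs)" by (fact cring_Cons)

lemma RDirProd_list_Cons_minus:
  assumes "e \<in> carrier R" "b \<in> carrier R"
    and "es \<in> carrier (RDirProd_list Rs)" "bs \<in> carrier (RDirProd_list Rs)"
  shows "(e # es) \<ominus>\<^bsub>RDirProd_list (R # Rs)\<^esub> (b # bs) = (e \<ominus>\<^bsub>R\<^esub> b) # (es \<ominus>\<^bsub>RDirProd_list Rs\<^esub> bs)"
proof -
  let ?c = "(e \<ominus>\<^bsub>R\<^esub> b) # (es \<ominus>\<^bsub>RDirProd_list Rs\<^esub> bs)"
  \<comment> \<open>The difference is found as the element that gives \<open>e # es\<close> when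
    \<open>b # bs\<close> is added, so negatives in the product need not be computed.\<close>
  have "?c \<oplus>\<^bsub>RDirProd_list (R # Rs)\<^esub> (b # bs) = e # es"
    using assms by (subst RDirProd_list_Cons_simps)
      (auto simp: R.minus_eq Rs.minus_eq R.a_assoc Rs.a_assoc R.l_neg Rs.l_neg)
  then have "(e # es) \<ominus>\<^bsub>RDirProd_list (R # Rs)\<^esub> (b # bs) =
      ?c \<oplus>\<^bsub>RDirProd_list (R # Rs)\<^esub> (b # bs) \<ominus>\<^bsub>RDirProd_list (R # Rs)\<^esub> (b # bs)"
    by simp
  also have "\<dots> = ?c"
    using assms by (simp add: RRs.minus_eq RRs.a_assoc RRs.r_neg)
  finally show ?thesis .
qed

lemma Units_RDirProd_list_Cons:
  "Units (RDirProd_list (R # Rs)) = (\<lambda>(u, us). u # us) ` (Units R \<times> Units (RDirProd_list Rs))"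
proof (intro equalityI subsetI)
  fix v assume "v \<in> Units (RDirProd_list (R # Rs))"
  then obtain w where v: "v \<in> carrier (RDirProd_list (R # Rs))"
    and w: "w \<in> carrier (RDirProd_list (R # Rs))"
    and inv: "w \<otimes>\<^bsub>RDirProd_list (R # Rs)\<^esub> v = \<one>\<^bsub>RDirProd_list (R # Rs)\<^esub>"
      "v \<otimes>\<^bsub>RDirProd_list (R # Rs)\<^esub> w = \<one>\<^bsub>RDirProd_list (R # Rs)\<^esub>"
    unfolding Units_def by auto
  from v obtain u us where u: "v = u # us" "u \<in> carrier R" "us \<in> carrier (RDirProd_list Rs)"
    unfolding RDirProd_list_carrier by auto
  from w obtain t ts where t: "w = t # ts" "t \<in> carrier R" "ts \<in> carrier (RDirProd_list Rs)"
    unfolding RDirProd_list_carrier by auto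
  from inv u t have "u \<in> Units R" "us \<in> Units (RDirProd_list Rs)"
    unfolding Units_def by (auto simp: RDirProd_list_Cons_simps RDirProd_list_one')
  with u show "v \<in> (\<lambda>(u, us). u # us) ` (Units R \<times> Units (RDirProd_list Rs))" by auto
next
  fix v assume "v \<in> (\<lambda>(u, us). u # us) ` (Units R \<times> Units (RDirProd_list Rs))"
  then obtain u us where v: "v = u # us" and u: "u \<in> Units R" "us \<in> Units (RDirProd_list Rs)"
    by auto
  let ?w = "inv\<^bsub>R\<^esub> u # inv\<^bsub>RDirProd_list Rs\<^esub> us"
  have "?w \<otimes>\<^bsub>RDirProd_list (R # Rs)\<^esub> v = \<one>\<^bsub>RDirProd_list (R # Rs)\<^esub>"
    "v \<otimes>\<^bsub>RDirProd_list (R # Rs)\<^esub> ?w = \<one>\<^bsub>RDirProd_list (R # Rs)\<^esub>"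
    using u by (simp_all add: v RDirProd_list_Cons_simps RDirProd_list_one' R.Units_closed Rs.Units_closed)
  moreover have "v \<in> carrier (RDirProd_list (R # Rs))" "?w \<in> carrier (RDirProd_list (R # Rs))"
    using u by (simp_all add: v R.Units_closed Rs.Units_closed)
  ultimately show "v \<in> Units (RDirProd_list (R # Rs))" unfolding Units_def by blast
qed

lemma unit_multiples_RDirProd_list_Cons:
  assumes "e \<in> carrier R" and "es \<in> carrier (RDirProd_list Rs)"
  shows "unit_multiples (RDirProd_list (R # Rs)) (e # es) =
    (\<lambda>(b, bs). b # bs) ` (unit_multiples R e \<times> unit_multiples (RDirProd_list Rs) es)"
proof -
  have "unit_multiples (RDirProd_list (R # Rs)) (e # es) =
      (\<lambda>u. (e # es) \<otimes>\<^bsub>RDirProd_list (R # Rs)\<^esub> u) ` (\<lambda>(u, us). u # us) ` (Units R \<times> Units (RDirProd_list Rs))"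
    unfolding unit_multiples_def Units_RDirProd_list_Cons by blast
  also have "\<dots> = (\<lambda>(u, us). (e \<otimes>\<^bsub>R\<^esub> u) # (es \<otimes>\<^bsub>RDirProd_list Rs\<^esub> us)) ` (Units R \<times> Units (RDirProd_list Rs))"
    unfolding image_image using assms
    by (intro image_cong) (auto simp: RDirProd_list_Cons_simps R.Units_closed Rs.Units_closed)
  also have "\<dots> = (\<lambda>(b, bs). b # bs) ` (unit_multiples R e \<times> unit_multiples (RDirProd_list Rs) es)"
    unfolding unit_multiples_def by fastforce
  finally show ?thesis .
qed

lemma genideal_RDirProd_list_Cons:
  assumes "e \<in> carrier R" and "es \<in> carrier (RDirProd_list Rs)"
  shows "Idl\<^bsub>RDirProd_list (R # Rs)\<^esub> {e # es} =
    (\<lambda>(b, bs). b # bs) ` ((Idl\<^bsub>R\<^esub> {e}) \<times> (Idl\<^bsub>RDirProd_list Rs\<^esub> {es}))"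
proof -
  have "Idl\<^bsub>RDirProd_list (R # Rs)\<^esub> {e # es} =
      (\<lambda>r. r \<otimes>\<^bsub>RDirProd_list (R # Rs)\<^esub> (e # es)) ` (\<lambda>(r, rs). r # rs) ` (carrier R \<times> carrier (RDirProd_list Rs))"
    using assms by (subst RRs.cgenideal_eq_genideal[symmetric])
      (auto simp: cgenideal_def RDirProd_list_carrier)
  also have "\<dots> = (\<lambda>(r, rs). (r \<otimes>\<^bsub>R\<^esub> e) # (rs \<otimes>\<^bsub>RDirProd_list Rs\<^esub> es)) ` (carrier R \<times> carrier (RDirProd_list Rs))"
    unfolding image_image using assms
    by (intro image_cong) (auto simp: RDirProd_list_Cons_simps)
  also have "\<dots> = (\<lambda>(b, bs). b # bs) ` ((Idl\<^bsub>R\<^esub> {e}) \<times> (Idl\<^bsub>RDirProd_list Rs\<^esub> {es}))"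
    unfolding R.cgenideal_eq_genideal[OF assms(1), symmetric]
      Rs.cgenideal_eq_genideal[OF assms(2), symmetric] cgenideal_def
    by fastforce
  finally show ?thesis .
qed

text \<open>A walk in the product is a pair of walks of the same length in the two factors, because
  the connection set is itself a product.\<close>

lemma walks_RDirProd_list_Cons:
  assumes "g \<in> carrier R" and "gs \<in> carrier (RDirProd_list Rs)"
  shows "walks (RDirProd_list (R # Rs)) ((\<lambda>(b, bs). b # bs) ` (S \<times> T)) k (g # gs) =
    walks R S k g * walks (RDirProd_list Rs) T k gs"
  using assms
proof (induction k arbitrary: g gs)
  case 0
  then show ?case by (simp add: RDirProd_list_zero')
next
  case (Suc k)
  let ?c = "\<lambda>(b, bs). b # bs"
  let ?H = "{h. h \<in> carrier R \<and> g \<ominus>\<^bsub>R\<^esub> h \<in> S}"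
    and ?Hs = "{h. h \<in> carrier (RDirProd_list Rs) \<and> gs \<ominus>\<^bsub>RDirProd_list Rs\<^esub> h \<in> T}"
    and ?K = "{h. h \<in> carrier (RDirProd_list (R # Rs)) \<and> (g # gs) \<ominus>\<^bsub>RDirProd_list (R # Rs)\<^esub> h \<in> ?c ` (S \<times> T)}"
  have K: "?K = ?c ` (?H \<times> ?Hs)"
    using Suc.prems unfolding RDirProd_list_carrier
    by (auto simp: RDirProd_list_Cons_minus image_iff)
  have "(\<Sum>h\<in>?K. walks (RDirProd_list (R # Rs)) (?c ` (S \<times> T)) k h) =
      (\<Sum>p\<in>?H \<times> ?Hs. walks (RDirProd_list (R # Rs)) (?c ` (S \<times> T)) k (?c p))"
    unfolding K by (subst sum.reindex) (auto simp: inj_on_def)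
  also have "\<dots> = (\<Sum>(h, hs)\<in>?H \<times> ?Hs. walks R S k h * walks (RDirProd_list Rs) T k hs)"
    using Suc.IH by (intro sum.cong) auto
  also have "\<dots> = walks R S (Suc k) g * walks (RDirProd_list Rs) T (Suc k) gs"
    by (simp add: sum_product sum.cartesian_product)
  finally show ?case by simp
qed

end

text \<open>The four formulas share one induction over the factors, each splitting off the head of
  the list.\<close>

lemma RDirProd_list_products:
  assumes "\<And>i. i < length Rs \<Longrightarrow> cring (Rs ! i)" and "x \<in> carrier (RDirProd_list Rs)"
  shows card_carrier_RDirProd_list:
      "card (carrier (RDirProd_list Rs)) = (\<Prod>i<length Rs. card (carrier (Rs ! i)))"
    and card_unit_multiples_RDirProd_list:
      "card (unit_multiples (RDirProd_list Rs) x) =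
        (\<Prod>i<length Rs. card (unit_multiples (Rs ! i) (x ! i)))"
    and card_genideal_RDirProd_list:
      "card (Idl\<^bsub>RDirProd_list Rs\<^esub> {x}) = (\<Prod>i<length Rs. card (Idl\<^bsub>Rs ! i\<^esub> {x ! i}))"
    and walks_RDirProd_list:
      "walks (RDirProd_list Rs) (unit_multiples (RDirProd_list Rs) x) k \<zero>\<^bsub>RDirProd_list Rs\<^esub> =
        (\<Prod>i<length Rs. walks (Rs ! i) (unit_multiples (Rs ! i) (x ! i)) k \<zero>\<^bsub>Rs ! i\<^esub>)"
proof -
  have "card (carrier (RDirProd_list Rs)) = (\<Prod>i<length Rs. card (carrier (Rs ! i))) \<and>
      card (unit_multiples (RDirProd_list Rs) x) =
        (\<Prod>i<length Rs. card (unit_multiples (Rs ! i) (x ! i))) \<and>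
      card (Idl\<^bsub>RDirProd_list Rs\<^esub> {x}) = (\<Prod>i<length Rs. card (Idl\<^bsub>Rs ! i\<^esub> {x ! i})) \<and>
      walks (RDirProd_list Rs) (unit_multiples (RDirProd_list Rs) x) k \<zero>\<^bsub>RDirProd_list Rs\<^esub> =
        (\<Prod>i<length Rs. walks (Rs ! i) (unit_multiples (Rs ! i) (x ! i)) k \<zero>\<^bsub>Rs ! i\<^esub>)"
    using assms
  proof (induction Rs arbitrary: x)
    case Nil
    \<comment> \<open>The empty product is the zero ring. Its only element is a unit, and its single
      vertex carries a loop, so all four counts equal the empty product 1.\<close>
    let ?N = "nil_ring :: 'a list ring"
    interpret cring ?N using RDirProd_list_is_cring[of "[]"] by simp
    have x: "x = []" using Nil by simp
    have units: "unit_multiples ?N [] = {[]}"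
      using Units_one_closed Units_closed by (auto simp: unit_multiples_def monoid.defs)
    have minus: "e \<ominus>\<^bsub>?N\<^esub> b = []" if "e \<in> carrier ?N" "b \<in> carrier ?N" for e b
      using minus_closed[OF that] by simp
    have zero: "\<zero>\<^bsub>?N\<^esub> = []" by (simp add: monoid.defs)
    have "walks ?N {[]} k [] = 1"
      by (induction k) (simp_all add: zero minus Collect_conv_if cong: conj_cong)
    then show ?case using genideal_zero by (simp add: x units zero)
  next
    case (Cons R Rs)
    have R: "cring R" using Cons.prems(1)[of 0] by simp
    have factors: "\<And>i. i < length Rs \<Longrightarrow> cring (Rs ! i)" using Cons.prems(1)[of "Suc _"] by simp
    have Rs: "cring (RDirProd_list Rs)" using factors by (rule RDirProd_list_is_cring)
    have RRs: "cring (RDirProd_list (R # Rs))" using Cons.prems(1) by (rule RDirProd_list_is_cring)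
    interpret R: cring R by (fact R)
    interpret Rs: cring "RDirProd_list Rs" by (fact Rs)
    obtain e es where x: "x = e # es" and e: "e \<in> carrier R" and es: "es \<in> carrier (RDirProd_list Rs)"
      using Cons.prems(2) unfolding RDirProd_list_carrier by auto
    have inj: "inj_on (\<lambda>(b, bs). b # bs) A" for A :: "('a \<times> 'a list) set"
      by (auto simp: inj_on_def)
    note Cons_rules = unit_multiples_RDirProd_list_Cons[OF R Rs RRs e es]
      genideal_RDirProd_list_Cons[OF R Rs RRs e es] walks_RDirProd_list_Cons[OF R Rs RRs]
    show ?case
      using Cons.IH[OF factors es]
      unfolding x RDirProd_list_carrier RDirProd_list_zero' Cons_rules length_Cons prod.lessThan_Suc_shift
      by (simp add: card_image[OF inj] card_cartesian_product Cons_rules)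
  qed
  then show "card (carrier (RDirProd_list Rs)) = (\<Prod>i<length Rs. card (carrier (Rs ! i)))"
    and "card (unit_multiples (RDirProd_list Rs) x) =
        (\<Prod>i<length Rs. card (unit_multiples (Rs ! i) (x ! i)))"
    and "card (Idl\<^bsub>RDirProd_list Rs\<^esub> {x}) = (\<Prod>i<length Rs. card (Idl\<^bsub>Rs ! i\<^esub> {x ! i}))"
    and "walks (RDirProd_list Rs) (unit_multiples (RDirProd_list Rs) x) k \<zero>\<^bsub>RDirProd_list Rs\<^esub> =
        (\<Prod>i<length Rs. walks (Rs ! i) (unit_multiples (Rs ! i) (x ! i)) k \<zero>\<^bsub>Rs ! i\<^esub>)"
    by blast+
qed

section \<open>Contribution of a single local factor\<close>

lemma (in abelian_group) card_additive_subgroup: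
  assumes I: "additive_subgroup I G" and fin: "finite (carrier G)"
  shows "card I dvd card (carrier G)" and "card I > 0"
proof -
  interpret I: additive_subgroup I G by (fact I)
  show "card I > 0"
    using finite_subset[OF I.a_subset fin] I.zero_closed unfolding card_gt_0_iff by blast
  have "card (carrier G) = card (a_rcosets I) * card I"
    using a_lagrange[OF fin I] by (simp add: Coset.order_def)
  then show "card I dvd card (carrier G)" by (rule dvdI[OF trans[OF _ mult.commute]])
qed

text \<open>The last claim is the power sum of a spectrum with eigenvalue \<open>|yR*|\<close> of
  multiplicity \<open>c\<close>, eigenvalue \<open>-|yR*| / q = -|M|\<close> of multiplicity
  \<open>c * q\<close>, and otherwise 0. The divisibility makes these multiplicities
  integers.\<close>

lemma local_ring_unit_multiples:
  fixes R (structure)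
  assumes loc: "local_ring R" and fin: "finite (carrier R)"
    and y: "y \<in> carrier R" and y_nonzero: "y \<noteq> \<zero>"
  defines "q \<equiv> real (card (unit_multiples R y)) / real (card (nonunit_multiples R y))"
    and "c \<equiv> real (card (carrier R)) / real (card (Idl {y}))"
  shows "card (nonunit_multiples R y) dvd card (carrier R)"
    and "card (nonunit_multiples R y) > 0"
    and "card (unit_multiples R y) > 0"
    and "card (unit_multiples R y) + card (nonunit_multiples R y) = card (Idl {y})"
    and "k > 0 \<Longrightarrow> real (card (carrier R)) * real (walks R (unit_multiples R y) k \<zero>) =
      c * (real (card (unit_multiples R y)) ^ k + q * (- (real (card (unit_multiples R y)) / q)) ^ k)"
proof -
  interpret cring R using loc by (simp add: local_ring_def)
  let ?S = "unit_multiples R y" and ?M = "nonunit_multiples R y"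
  have M: "additive_subgroup ?M R"
    by (rule local_ring_nonunit_multiples_subgroup[OF loc fin y y_nonzero])
  interpret I: ideal "Idl {y}" R using y by (intro genideal_ideal) auto
  have S_subset: "?S \<subseteq> Idl {y}" by (rule unit_multiples_subset_genideal[OF is_cring y])
  have S: "?S = Idl {y} - ?M" and M_subset: "?M \<subseteq> Idl {y}"
    using S_subset by (auto simp: nonunit_multiples_def)
  have fin_I: "finite (Idl {y})" using fin I.a_subset finite_subset by blast
  show M_pos: "card ?M > 0"
    by (rule card_additive_subgroup(2)[OF M fin])
  show "card ?M dvd card (carrier R)"
    by (rule card_additive_subgroup(1)[OF M fin])
  have "y \<otimes> \<one> \<in> ?S" unfolding unit_multiples_def by blast
  then show S_pos: "card ?S > 0"
    using finite_subset[OF S_subset fin_I] unfolding card_gt_0_iff by blast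
  show card_I: "card ?S + card ?M = card (Idl {y})"
    using fin_I M_subset finite_subset[OF M_subset fin_I] card_mono[OF fin_I M_subset]
    unfolding S by (simp add: card_Diff_subset)
  assume k: "k > 0"
  have quot: "real (card ?S) / q = card ?M"
    using S_pos M_pos by (simp add: q_def)
  have "card (Idl {y}) - card ?M = card ?S" using card_I by simp
  then have "real (walks R ?S k \<zero>) =
      (real (card ?S) ^ k - (- real (card ?M)) ^ k) / card (Idl {y}) + (- real (card ?M)) ^ k / card ?M"
    using walks_subgroup_diff[OF fin I.additive_subgroup_axioms M M_subset zero_closed k]
      I.zero_closed additive_subgroup.zero_closed[OF M] S by simp
  also have "card (Idl {y}) = card ?S + card ?M" using card_I by simp
  finally show "real (card (carrier R)) * real (walks R ?S k \<zero>) =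
      c * (real (card ?S) ^ k + q * (- (real (card ?S) / q)) ^ k)"
    using S_pos M_pos unfolding quot c_def card_I[symmetric]
    by (simp add: q_def divide_simps) (simp add: algebra_simps)
qed

text \<open>This treats the factors with \<open>x ! i = 0\<close>: their graph has just a loop at
  each vertex, hence one closed walk of every length.\<close>

lemma zero_unit_multiples:
  fixes R (structure)
  assumes "cring R" and fin: "finite (carrier R)"
  shows "Idl {\<zero>} = {\<zero>}" and "unit_multiples R \<zero> = {\<zero>}"
    and "walks R {\<zero>} k \<zero> = 1"
proof -
  interpret cring R by fact
  show "Idl {\<zero>} = {\<zero>}" by (rule genideal_zero)
  show "unit_multiples R \<zero> = {\<zero>}"
    by (auto simp: unit_multiples_def Units_closed intro!: exI[of _ \<one>])
  show "walks R {\<zero>} k \<zero> = 1"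
  proof (induction k)
    case (Suc k)
    have "{h. h \<in> carrier R \<and> \<zero> \<ominus> h \<in> {\<zero>}} = {\<zero>}" by auto
    with Suc show ?case by simp
  qed simp
qed

section \<open>The spectrum of the product\<close>

lemma sum_image_mset_sum:
  "(\<Sum>z\<in>#(\<Sum>x\<in>A. F x). f z) = (\<Sum>x\<in>A. \<Sum>z\<in>#F x. f z)"
  by (induction A rule: infinite_finite_induct) auto

text \<open>The multiplicities are asserted to exist as natural numbers, so the claim includes that
  the stated quotients are integral and that the multiplicity of 0 is nonnegative. If several
  subsets \<open>C\<close> give the same value, the multiset sum adds their multiplicities.\<close>

theorem theorem3p8:
  fixes Rs :: "('a, 'm) ring_scheme list" and R :: "'a list ring"
    and x :: "'a list" and vs :: "'a list list"
    and P :: "nat set" and q :: "nat \<Rightarrow> real"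
  assumes local_factors: "\<And>i. i < length Rs \<Longrightarrow> local_ring (Rs ! i) \<and> finite (carrier (Rs ! i))"
    and R_eq: "R = RDirProd_list Rs"
    and x_in: "x \<in> carrier R"
    and x_nonzero: "x \<noteq> \<zero>\<^bsub>R\<^esub>"
    and P_eq: "P = {i. i < length Rs \<and> x ! i \<noteq> \<zero>\<^bsub>Rs ! i\<^esub>}"
    and q_eq: "q = (\<lambda>i. real (card (unit_multiples (Rs ! i) (x ! i)))
                        / real (card (nonunit_multiples (Rs ! i) (x ! i))))"
    and vs_enum: "distinct vs" "set vs = pverts (Cay R (unit_multiples R x))"
  shows "\<exists>(m :: nat set \<Rightarrow> nat) (m0 :: nat).
    (\<forall>C. C \<subseteq> P \<longrightarrow>
       real (m C) = real (card (carrier R)) / real (card (Idl\<^bsub>R\<^esub> {x})) * (\<Prod>i\<in>C. q i)) \<and>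
    real m0 = real (card (carrier R))
       - real (card (carrier R)) / real (card (Idl\<^bsub>R\<^esub> {x})) * (\<Prod>i\<in>P. 1 + q i) \<and>
    eigenvalue_mset (adjacency_matrix (Cay R (unit_multiples R x)) vs) =
      (\<Sum>C\<in>Pow P. replicate_mset (m C)
         (complex_of_real ((-1) ^ card C * (real (card (unit_multiples R x)) / (\<Prod>i\<in>C. q i)))))
      + replicate_mset m0 0"
proof -
  define n where "n = length Rs"
  define cR where "cR i = card (carrier (Rs ! i))" for i
  define cI where "cI i = card (Idl\<^bsub>Rs ! i\<^esub> {x ! i})" for i
  define cS where "cS i = card (unit_multiples (Rs ! i) (x ! i))" for i
  define cM where "cM i = card (nonunit_multiples (Rs ! i) (x ! i))" for i
  define W where "W k i = walks (Rs ! i) (unit_multiples (Rs ! i) (x ! i)) k \<zero>\<^bsub>Rs ! i\<^esub>" for k i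
  define r where "r i = real (cR i) / real (cI i)" for i
  define ratio where "ratio = real (card (carrier R)) / real (card (Idl\<^bsub>R\<^esub> {x}))"
  define S where "S = unit_multiples R x"

  have fin_P: "finite P" and P_subset: "P \<subseteq> {..<n}" by (auto simp: P_eq n_def)
  have cring_factor: "cring (Rs ! i)" if "i < length Rs" for i
    using local_factors[OF that] by (simp add: local_ring_def)
  interpret cring R unfolding R_eq by (rule RDirProd_list_is_cring[OF cring_factor])
  have x_i: "x ! i \<in> carrier (Rs ! i)" if "i < n" for i
    using RDirProd_list_carrier_mem(2)[of x Rs] x_in that by (simp add: R_eq n_def)
  note products = RDirProd_list_products[OF cring_factor x_in[unfolded R_eq], folded R_eq]
  have card_R: "card (carrier R) = (\<Prod>i<n. cR i)"
    and card_S: "card S = (\<Prod>i<n. cS i)"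
    and card_I: "card (Idl\<^bsub>R\<^esub> {x}) = (\<Prod>i<n. cI i)"
    and walks_R: "walks R S k \<zero>\<^bsub>R\<^esub> = (\<Prod>i<n. W k i)" for k
    using products by (simp_all add: n_def cR_def cS_def cI_def W_def S_def)
  have ratio: "ratio = (\<Prod>i<n. r i)"
    by (simp add: ratio_def r_def card_R card_I prod_dividef)

  have cI_dvd: "cI i dvd cR i" and cI_pos: "cI i > 0" if i: "i < n" for i
  proof -
    interpret Ri: cring "Rs ! i" using cring_factor i by (simp add: n_def)
    interpret Ii: ideal "Idl\<^bsub>Rs ! i\<^esub> {x ! i}" "Rs ! i"
      using x_i[OF i] by (intro Ri.genideal_ideal) auto
    show "cI i dvd cR i" "cI i > 0"
      using Ri.card_additive_subgroup[OF Ii.additive_subgroup_axioms] local_factors i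
      by (simp_all add: cI_def cR_def n_def)
  qed
  have cM_dvd: "cM i dvd cR i" and cM_pos: "cM i > 0" and cS_pos: "cS i > 0"
    and cI_eq: "cI i = cS i + cM i"
    and walks_P: "k > 0 \<Longrightarrow> cR i * W k i = r i * (cS i ^ k + q i * (- (cS i / q i)) ^ k)"
    if "i \<in> P" for i k
    using that local_ring_unit_multiples[of "Rs ! i" "x ! i"] local_factors x_i
    by (auto simp: P_eq n_def cM_def cR_def cS_def cI_def W_def r_def q_eq)
  have cS_1: "cS i = 1" and cI_1: "cI i = 1" and W_1: "W k i = 1" if "i < n" "i \<notin> P" for i k
    using that zero_unit_multiples[OF cring_factor, of i] local_factors
    by (auto simp: P_eq n_def cS_def cI_def W_def)
  have q: "q i = cS i / cM i" for i by (simp add: q_eq cS_def cM_def)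
  have q_pos: "q i > 0" if "i \<in> P" for i using that cS_pos cM_pos by (simp add: q)

  \<comment> \<open>For \<open>i\<close> in \<open>C\<close>, \<open>r i * q i\<close> equals
    \<open>|R_i| / |M_i| - |R_i| / |I_i|\<close> because \<open>|I_i|\<close> is the sum of
    \<open>cS i\<close> and \<open>cM i\<close>. Both divisions are exact, which yields a natural
    number.\<close>
  define m where "m C = (\<Prod>i\<in>C. cR i div cM i - cR i div cI i) * (\<Prod>i\<in>{..<n} - C. cR i div cI i)"
    for C
  have m: "real (m C) = ratio * (\<Prod>i\<in>C. q i)" if C: "C \<subseteq> P" for C
  proof -
    have factor_C: "real (cR i div cM i - cR i div cI i) = r i * q i" if "i \<in> C" for i
    proof -
      have i: "i \<in> P" "i < n" using that C P_subset by auto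
      \<comment> \<open>This keeps the subtraction of natural numbers from being truncated.\<close>
      then have "cR i div cI i \<le> cR i div cM i"
        using cM_pos cI_eq by (intro div_le_mono2) auto
      then have "real (cR i div cM i - cR i div cI i) = cR i / cM i - cR i / cI i"
        using i cM_dvd cI_dvd by (simp add: of_nat_diff real_of_nat_div)
      also have "\<dots> = r i * q i"
        using i cM_pos[of i] cI_pos[of i] cI_eq[of i] by (simp add: r_def q field_simps)
      finally show ?thesis .
    qed
    have "real (m C) = (\<Prod>i\<in>C. r i * q i) * (\<Prod>i\<in>{..<n} - C. r i)"
      unfolding m_def of_nat_mult of_nat_prod
      by (intro arg_cong2[where f = "(*)"] prod.cong)
        (use factor_C cI_dvd in \<open>auto simp: r_def real_of_nat_div\<close>)
    also have "\<dots> = (\<Prod>i\<in>{..<n} - C. r i) * (\<Prod>i\<in>C. r i) * (\<Prod>i\<in>C. q i)"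
      by (simp add: prod.distrib)
    also have "(\<Prod>i\<in>{..<n} - C. r i) * (\<Prod>i\<in>C. r i) = ratio"
      unfolding ratio using C P_subset by (intro prod.subset_diff[symmetric]) auto
    finally show ?thesis .
  qed
  have sum_m: "(\<Sum>C\<in>Pow P. real (m C)) = ratio * (\<Prod>i\<in>P. 1 + q i)"
    using fin_P m by (simp add: sum_distrib_left prod_add add.commute[of 1])
  have "ratio * (\<Prod>i\<in>P. 1 + q i) = (\<Prod>i<n. r i * (if i \<in> P then 1 + q i else 1))"
    using P_subset by (simp add: ratio prod.distrib prod.If_cases Int_absorb1)
  \<comment> \<open>The bound holds factor by factor: for \<open>i\<close> in \<open>P\<close> the
    factor is \<open>|R_i| / |M_i|\<close>, and for the others it is \<open>|R_i|\<close>.\<close>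
  also have "\<dots> \<le> (\<Prod>i<n. real (cR i))"
  proof (rule prod_mono)
    fix i assume "i \<in> {..<n}"
    then have i: "i < n" by simp
    show "0 \<le> r i * (if i \<in> P then 1 + q i else 1) \<and> r i * (if i \<in> P then 1 + q i else 1) \<le> real (cR i)"
    proof (cases "i \<in> P")
      case True
      have "r i * (1 + q i) = cR i / cM i"
      proof -
        have "1 + q i = cI i / cM i"
          using cM_pos[OF True] cI_eq[OF True] by (simp add: q field_simps)
        then show ?thesis using cI_pos[OF i] by (simp add: r_def)
      qed
      also have "\<dots> \<le> cR i" using True cM_pos[of i] by (simp add: divide_simps mult_le_cancel_left1)
      finally show ?thesis using True q_pos[of i] by (simp add: r_def)
    qed (use i cI_1 in \<open>simp add: r_def\<close>)
  qed
  finally have "(\<Sum>C\<in>Pow P. real (m C)) \<le> card (carrier R)"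
    by (simp add: sum_m card_R)
  then have sum_m_le: "(\<Sum>C\<in>Pow P. m C) \<le> card (carrier R)"
    by (simp only: of_nat_sum[symmetric] of_nat_le_iff)
  \<comment> \<open>The preceding bound makes this a true difference; it is chosen so that
    \<open>T\<close> has \<open>|R|\<close> elements.\<close>
  define m0 where "m0 = card (carrier R) - (\<Sum>C\<in>Pow P. m C)"
  have m0: "real m0 = card (carrier R) - ratio * (\<Prod>i\<in>P. 1 + q i)"
    using sum_m_le by (simp add: m0_def of_nat_diff flip: sum_m)

  define ev where "ev C = (-1) ^ card C * (real (card S) / (\<Prod>i\<in>C. q i))" for C
  define T where "T = (\<Sum>C\<in>Pow P. replicate_mset (m C) (complex_of_real (ev C))) + replicate_mset m0 0"
  let ?A = "adjacency_matrix (Cay R S) vs :: complex mat"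
  have vs: "set vs = carrier R" using vs_enum by (simp add: Cay_def)
  have length_vs: "length vs = card (carrier R)" using vs_enum(1) vs distinct_card by metis
  have A: "?A \<in> carrier_mat (length vs) (length vs)" by (simp add: adjacency_matrix_def)

  have "eigenvalue_mset ?A = T"
  proof (rule multiset_eq_if_power_sums_eq)
    fix k :: nat
    show "(\<Sum>z\<in>#eigenvalue_mset ?A. z ^ k) = (\<Sum>z\<in>#T. z ^ k)"
    proof (cases "k = 0")
      \<comment> \<open>The exponent 0 compares sizes, where the copies of 0 count too. For
        \<open>k > 0\<close> they vanish and the local walk formula applies.\<close>
      case True
      have "size (\<Sum>C\<in>A. replicate_mset (m C) (complex_of_real (ev C))) = sum m A" for A
        by (induction A rule: infinite_finite_induct) auto
      then have "size T = card (carrier R)" using sum_m_le by (simp add: T_def m0_def)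
      then show ?thesis using True size_eigenvalue_mset[OF A] length_vs by simp
    next
      case False
      then have k: "k > 0" by simp
      have ev_power: "real (m C) * ev C ^ k = ratio * card S ^ k * (\<Prod>i\<in>C. q i * (- 1 / q i) ^ k)"
        if "C \<subseteq> P" for C
      proof -
        \<comment> \<open>The sign is absorbed into the product, one factor -1 for each element of
          \<open>C\<close>.\<close>
        have "ev C = card S * (\<Prod>i\<in>C. - 1 / q i)"
          unfolding ev_def prod_dividef prod_constant by simp
        then show ?thesis
          using that by (simp add: m prod.distrib power_mult_distrib prod_power_distrib)
      qed
      have "(\<Sum>z\<in>#T. z ^ k) = (\<Sum>C\<in>Pow P. of_nat (m C) * complex_of_real (ev C) ^ k)"
        using k by (simp add: T_def sum_image_mset_sum)
      also have "\<dots> = complex_of_real (\<Sum>C\<in>Pow P. real (m C) * ev C ^ k)" by simp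
      \<comment> \<open>The sum over all subsets is the expansion of a product of binomials over
        \<open>P\<close>.\<close>
      also have "(\<Sum>C\<in>Pow P. real (m C) * ev C ^ k) =
          ratio * card S ^ k * (\<Prod>i\<in>P. q i * (- 1 / q i) ^ k + 1)"
        using fin_P ev_power by (simp add: prod_add sum_distrib_left)
      also have "\<dots> = (\<Prod>i<n. r i * real (cS i) ^ k * (if i \<in> P then q i * (- 1 / q i) ^ k + 1 else 1))"
        using P_subset
        by (simp add: ratio card_S prod.distrib prod_power_distrib prod.If_cases Int_absorb1)
      also have "\<dots> = (\<Prod>i<n. real (cR i) * real (W k i))"
      proof (rule prod.cong)
        fix i assume "i \<in> {..<n}"
        then have i: "i < n" by simp
        show "r i * real (cS i) ^ k * (if i \<in> P then q i * (- 1 / q i) ^ k + 1 else 1) =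
            real (cR i) * real (W k i)"
        proof (cases "i \<in> P")
          case True
          have "- (cS i / q i) = cS i * (- 1 / q i)" by simp
          then have "(- (cS i / q i)) ^ k = cS i ^ k * (- 1 / q i) ^ k"
            by (simp only: power_mult_distrib of_nat_power)
          then show ?thesis using True walks_P[OF True k] by (simp add: algebra_simps)
        qed (use i cS_1 cI_1 W_1 in \<open>simp add: r_def\<close>)
      qed simp
      also have "\<dots> = card (carrier R) * walks R S k \<zero>\<^bsub>R\<^esub>"
        by (simp add: card_R walks_R prod.distrib)
      \<comment> \<open>Each of the \<open>|R|\<close> diagonal entries of the power counts closed
        walks at one vertex, the same number everywhere.\<close>
      also have "complex_of_real \<dots> = (\<Sum>i<length vs. of_nat (walks R S k \<zero>\<^bsub>R\<^esub>))"
        by (simp add: length_vs)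
      also have "\<dots> = (\<Sum>i<length vs. (?A ^\<^sub>m k) $$ (i, i))"
      proof (rule sum.cong)
        fix i assume "i \<in> {..<length vs}"
        then have i: "i < length vs" by simp
        then have "vs ! i \<in> carrier R" using vs nth_mem by blast
        moreover have "(?A ^\<^sub>m k) $$ (i, i) = of_nat (walks R S k (vs ! i \<ominus>\<^bsub>R\<^esub> vs ! i))"
          by (rule adjacency_matrix_Cay_pow[OF vs_enum(1) vs i i])
        ultimately show "of_nat (walks R S k \<zero>\<^bsub>R\<^esub>) = (?A ^\<^sub>m k) $$ (i, i)"
          by (simp add: minus_eq r_neg)
      qed simp
      also have "\<dots> = (\<Sum>z\<in>#eigenvalue_mset ?A. z ^ k)"
        using eigenvalue_mset_power_sum[OF A] by simp
      finally show ?thesis by simp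
    qed
  qed
  then show ?thesis
    using m m0 unfolding T_def ev_def S_def ratio_def by blast
qed

end
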